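(* Let $R\subseteq S$ be two entire rings (integral domains) with $S$ integral over $R$ and $R$ integrally closed. Let $\mathcal{C}_1$ be a saturated idealistic chain of $R$ and $\mathcal{C}_2$ a saturated idealistic chain of $S$, non empty. Let $I_\ell$ be the last of the ideals in the chain $\mathcal{C}_1$ and $I_{\ell+1}$ the first of the ideals in the chain $\mathcal{C}_2|_R$. Assume $I_\ell\subseteq I_{\ell+1}$. If the idealistic chain $\mathcal{C}_1\bullet\mathcal{C}_2$ collapses in $S$, then the idealistic chain $\mathcal{C}_2$ collapses in $S$.
   Context: For subsets $J,U$ of a ring $A$, $\langle J\rangle$ is the ideal generated by $J$ and $\mathcal{M}(U)$ the multiplicative monoid (containing $1$) generated by $U$. An idealistic prime in $A$ is a pair $(J,U)$ of subsets; an idealistic chain is a finite list $((J_0,U_0),\ldots,(J_k,U_k))$ of idealistic primes; its ideals are the $J_i$. It collapses in $A$ if there exist $j_i\in\langle J_i\rangle$, $u_i\in\mathcal{M}(U_i)$ with $u_0(u_1(\cdots(u_k+j_k)+\cdots)+j_1)+j_0=0$. A chain of $R$ is also regarded as a chain of $S\supseteq R$. $\bullet$ denotes concatenation of lists. A chain is complete if every $J_i$ is an ideal, every $U_i$ is a multiplicative monoid, $J_i+U_i=U_i$, and $J_i\subseteq J_{i+1}$, $U_{i+1}\subseteq U_i$. An ideal $I$ and a monoid $M$ are conjugate if: ($sa\in I$, $s\in M$ imply $a\in I$); ($a^n\in I$, $n>0$ imply $a\in I$); ($j\in I$, $s\in M$ imply $s+j\in M$); ($s_1s_2\in M$ implies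 $s_1\in M$). A chain is saturated if it is complete and each $J_i$ and $U_i$ are conjugate. The trace on $R$ of an idealistic prime $(J,V)$ of $S$ is $(J\cap R,V\cap R)$; the trace $\mathcal{C}|_R$ of a chain $\mathcal{C}$ of $S$ is the list of the traces of its members. *)

theory Defs
  imports
    "HOL-Algebra.Subrings"
    "HOL-Computational_Algebra.Computational_Algebra"
begin

text \<open>
  All rings are subrings \<open>A\<close> of one ambient commutative ring, given by the type \<open>'a\<close>; \<open>ring_on A\<close>
  is \<open>A\<close> as an HOL-Algebra structure with the operations of \<open>'a\<close>. The operations themselves are
  written with \<open>+\<close> and \<open>*\<close> of \<open>'a\<close>, and a subset of \<open>R\<close> needs no coercion to be a subset
  of a larger ring \<open>S\<close>.
\<close>

definition ring_on :: "'a::comm_ring_1 set \<Rightarrow> 'a ring" where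
  "ring_on A = \<lparr>carrier = A, monoid.mult = (*), one = 1, ring.zero = 0, add = (+)\<rparr>"

lemma ring_on_simps [simp]:
  "carrier (ring_on A) = A"
  "x \<otimes>\<^bsub>ring_on A\<^esub> y = x * y"
  "x \<oplus>\<^bsub>ring_on A\<^esub> y = x + y"
  "\<one>\<^bsub>ring_on A\<^esub> = 1"
  "\<zero>\<^bsub>ring_on A\<^esub> = 0"
  by (simp_all add: ring_on_def)

abbreviation subring_of_type :: "'a::comm_ring_1 set \<Rightarrow> bool" where
  "subring_of_type A \<equiv> subring A (ring_on UNIV)"

definition integral_over :: "'a::comm_ring_1 set \<Rightarrow> 'a \<Rightarrow> bool" where
  "integral_over A x \<longleftrightarrow>
     (\<exists>p :: 'a poly. Polynomial.lead_coeff p = 1 \<and> (\<forall>i. Polynomial.coeff p i \<in> A)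
        \<and> poly p x = 0)"

text \<open>The field of fractions of \<open>A\<close> is realised inside the field of fractions of \<open>'a\<close>.\<close>

definition fractions_of :: "'a::idom set \<Rightarrow> 'a fract set" where
  "fractions_of A = {Fraction_Field.Fract a b | a b. a \<in> A \<and> b \<in> A \<and> b \<noteq> 0}"

definition integrally_closed :: "'a::idom set \<Rightarrow> bool" where
  "integrally_closed A \<longleftrightarrow>
     (\<forall>x \<in> fractions_of A. integral_over (to_fract ` A) x \<longrightarrow> x \<in> to_fract ` A)"

definition monoid_gen :: "'a::comm_ring_1 set \<Rightarrow> 'a set \<Rightarrow> 'a set" where
  "monoid_gen A U = \<Inter>{M. submonoid M (ring_on A) \<and> U \<subseteq> M}"

text \<open>An idealistic prime is a pair \<open>(J, U)\<close>, an idealistic chain a list of such pairs.\<close>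

type_synonym 'a idealistic_chain = "('a set \<times> 'a set) list"

definition chain_ideals :: "'a idealistic_chain \<Rightarrow> 'a set list" where
  "chain_ideals C = map fst C"

definition chain_trace :: "'a set \<Rightarrow> 'a idealistic_chain \<Rightarrow> 'a idealistic_chain" where
  "chain_trace R C = map (\<lambda>(J, U). (J \<inter> R, U \<inter> R)) C"

text \<open>
  For \<open>[(j\<^sub>0,u\<^sub>0),\<dots>,(j\<^sub>k,u\<^sub>k)]\<close> this is \<open>u\<^sub>0(u\<^sub>1(\<dots>(u\<^sub>k + j\<^sub>k)\<dots>) + j\<^sub>1) + j\<^sub>0\<close>; the value \<open>1\<close> at \<open>[]\<close>
  yields the innermost term \<open>u\<^sub>k * 1 + j\<^sub>k\<close>.
\<close>

fun collapse_expr :: "('a::comm_ring_1 \<times> 'a) list \<Rightarrow> 'a" where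
  "collapse_expr [] = 1"
| "collapse_expr ((j, u) # ps) = u * collapse_expr ps + j"

definition collapses :: "'a::comm_ring_1 set \<Rightarrow> 'a idealistic_chain \<Rightarrow> bool" where
  "collapses A C \<longleftrightarrow>
     (\<exists>ps. list_all2 (\<lambda>(j, u) (J, U). j \<in> genideal (ring_on A) J \<and> u \<in> monoid_gen A U) ps C
        \<and> collapse_expr ps = 0)"

definition complete_chain :: "'a::comm_ring_1 set \<Rightarrow> 'a idealistic_chain \<Rightarrow> bool" where
  "complete_chain A C \<longleftrightarrow>
     (\<forall>(J, U) \<in> set C. ideal J (ring_on A) \<and> submonoid U (ring_on A)
        \<and> {j + u | j u. j \<in> J \<and> u \<in> U} = U)
     \<and> (\<forall>i. Suc i < length C \<longrightarrow>
          fst (C ! i) \<subseteq> fst (C ! Suc i) \<and> snd (C ! Suc i) \<subseteq> snd (C ! i))"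

definition conjugate :: "'a::comm_ring_1 set \<Rightarrow> 'a set \<Rightarrow> 'a set \<Rightarrow> bool" where
  "conjugate A I M \<longleftrightarrow>
     (\<forall>s \<in> M. \<forall>a \<in> A. s * a \<in> I \<longrightarrow> a \<in> I)
     \<and> (\<forall>a \<in> A. \<forall>n > 0. a ^ n \<in> I \<longrightarrow> a \<in> I)
     \<and> (\<forall>j \<in> I. \<forall>s \<in> M. s + j \<in> M)
     \<and> (\<forall>s1 \<in> A. \<forall>s2 \<in> A. s1 * s2 \<in> M \<longrightarrow> s1 \<in> M)"

definition saturated_chain :: "'a::comm_ring_1 set \<Rightarrow> 'a idealistic_chain \<Rightarrow> bool" where
  "saturated_chain A C \<longleftrightarrow> complete_chain A C \<and> (\<forall>(J, U) \<in> set C. conjugate A J U)"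

end

theory Submission
  imports Defs
    "HOL-Algebra.Algebraic_Closure_Type"
    "Jordan_Normal_Form.Char_Poly"
begin

text \<open>
  A complete chain collapses iff \<open>0\<close> lies in its first monoid, which contains all values of the
  collapse expression. So let \<open>x\<close> be the value contributed by \<open>C2\<close>; it suffices that some power of
  \<open>x\<close> lies in the first ideal of \<open>C2\<close>. This follows by peeling off the members \<open>(I, U)\<close> of \<open>C1\<close> one by
  one, if \<open>u z \<in> I S\<close> with \<open>u \<in> U\<close> implies \<open>z\<^sup>n \<in> I S\<close> for some \<open>n\<close>.

  For the latter, let \<open>X\<^sup>d + \<Sum> b\<^sub>i X\<^sup>i\<close> be the minimal polynomial of \<open>z\<close> over the fraction field of \<open>R\<close>
  and \<open>r\<close> its roots in an algebraic closure. They are integral over \<open>R\<close>, so \<open>b\<^sub>i \<in> R\<close> as \<open>R\<close> is integrally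
  closed. Since \<open>u z\<close> is integral over \<open>I\<close> by the determinant trick, each \<open>u r\<close> lies in the radical of
  the extension of \<open>I\<close> to the integral closure, and hence so does \<open>b\<^sub>i\<close> times \<open>u\<close> to the power \<open>d - i\<close>. That
  radical meets \<open>R\<close> in \<open>I\<close>, and elements of \<open>U\<close> cancel modulo \<open>I\<close>, so \<open>b\<^sub>i \<in> I\<close>.
\<close>

section \<open>Ideals of subrings\<close>

text \<open>A subring and an ideal of it, expressed with the operations of the type. The instance
  \<open>I = R\<close> says only that \<open>R\<close> is a subring, so one locale serves rings and
  ideals alike.\<close>

locale ring_ideal =
  fixes R I :: "'a::comm_ring_1 set"
  assumes ring_one: "1 \<in> R"
    and ring_minus: "x \<in> R \<Longrightarrow> - x \<in> R"
    and ring_add: "x \<in> R \<Longrightarrow> y \<in> R \<Longrightarrow> x + y \<in> R"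
    and ring_mult: "x \<in> R \<Longrightarrow> y \<in> R \<Longrightarrow> x * y \<in> R"
    and ideal_subset: "I \<subseteq> R"
    and ideal_zero: "0 \<in> I"
    and ideal_add: "x \<in> I \<Longrightarrow> y \<in> I \<Longrightarrow> x + y \<in> I"
    and ideal_mult: "r \<in> R \<Longrightarrow> x \<in> I \<Longrightarrow> r * x \<in> I"
begin

lemma ideal_in_ring: "x \<in> I \<Longrightarrow> x \<in> R"
  using ideal_subset by blast

lemma ring_zero: "0 \<in> R"
  using ideal_zero ideal_in_ring by blast

lemma ring_power: "x \<in> R \<Longrightarrow> x ^ n \<in> R"
  by (induction n) (auto intro: ring_one ring_mult)

lemma ring_of_nat: "of_nat n \<in> R"
  by (induction n) (auto intro: ring_zero ring_one ring_add)

lemma ring_sum: "(\<And>x. x \<in> A \<Longrightarrow> f x \<in> R) \<Longrightarrow> sum f A \<in> R"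
  by (induction A rule: infinite_finite_induct) (auto intro: ring_zero ring_add)

lemma ring_prod: "(\<And>x. x \<in> A \<Longrightarrow> f x \<in> R) \<Longrightarrow> prod f A \<in> R"
  by (induction A rule: infinite_finite_induct) (auto intro: ring_one ring_mult)

lemma ideal_mult_right: "x \<in> I \<Longrightarrow> r \<in> R \<Longrightarrow> x * r \<in> I"
  using ideal_mult[of r x] by (simp add: mult.commute)

lemma ideal_minus: "x \<in> I \<Longrightarrow> - x \<in> I"
  using ideal_mult[of "- 1" x] ring_minus[OF ring_one] by simp

lemma ideal_diff: "x \<in> I \<Longrightarrow> y \<in> I \<Longrightarrow> x - y \<in> I"
  using ideal_add[of x "- y"] ideal_minus[of y] by simp

lemma ideal_sum: "(\<And>x. x \<in> A \<Longrightarrow> f x \<in> I) \<Longrightarrow> sum f A \<in> I"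
  by (induction A rule: infinite_finite_induct) (auto intro: ideal_zero ideal_add)

lemma ideal_power_le:
  assumes "x \<in> R" "x ^ m \<in> I" "m \<le> n"
  shows "x ^ n \<in> I"
proof -
  have "x ^ n = x ^ (n - m) * x ^ m"
    using assms(3) by (simp flip: power_add)
  then show ?thesis
    using ideal_mult ring_power assms by simp
qed

lemma prod_cong_ideal:
  assumes "\<And>x. x \<in> A \<Longrightarrow> f x \<in> R" "\<And>x. x \<in> A \<Longrightarrow> g x \<in> R"
    and "\<And>x. x \<in> A \<Longrightarrow> f x - g x \<in> I"
  shows "prod f A - prod g A \<in> I"
  using assms
proof (induction A rule: infinite_finite_induct)
  case (insert a A)
  have "prod f (insert a A) - prod g (insert a A)
      = f a * (prod f A - prod g A) + (f a - g a) * prod g A"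
    using insert.hyps by (simp add: algebra_simps)
  moreover have "f a * (prod f A - prod g A) \<in> I"
    using insert by (intro ideal_mult) auto
  moreover have "(f a - g a) * prod g A \<in> I"
    using insert by (intro ideal_mult_right ring_prod) auto
  ultimately show ?case
    by (simp add: ideal_add)
qed (auto intro: ideal_zero)

text \<open>The determinant is a sum of signed products of entries, so it respects congruence modulo
  \<open>I\<close>. The determinant trick applies this to matrices of polynomials.\<close>

lemma det_cong_ideal:
  assumes A: "A \<in> carrier_mat n n" and B: "B \<in> carrier_mat n n"
    and "\<And>i j. i < n \<Longrightarrow> j < n \<Longrightarrow> A $$ (i, j) \<in> R"
    and "\<And>i j. i < n \<Longrightarrow> j < n \<Longrightarrow> B $$ (i, j) \<in> R"
    and "\<And>i j. i < n \<Longrightarrow> j < n \<Longrightarrow> A $$ (i, j) - B $$ (i, j) \<in> I"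
  shows "det A - det B \<in> I"
proof -
  have "det A - det B = (\<Sum>p | p permutes {0..<n}.
      signof p * ((\<Prod>i = 0..<n. A $$ (i, p i)) - (\<Prod>i = 0..<n. B $$ (i, p i))))"
    unfolding det_def'[OF A] det_def'[OF B] by (simp add: sum_subtractf right_diff_distrib)
  also have "\<dots> \<in> I"
  proof (rule ideal_sum)
    fix p assume "p \<in> {p. p permutes {0..<n}}"
    then have p: "p i < n" if "i < n" for i
      using that permutes_in_image[of p "{0..<n}" i] by simp
    have "signof p \<in> R"
      by (cases p rule: sign_cases) (auto intro: ring_one ring_minus)
    moreover have "(\<Prod>i = 0..<n. A $$ (i, p i)) - (\<Prod>i = 0..<n. B $$ (i, p i)) \<in> I"
      using assms p by (intro prod_cong_ideal) auto
    ultimately show "signof p * ((\<Prod>i = 0..<n. A $$ (i, p i)) - (\<Prod>i = 0..<n. B $$ (i, p i))) \<in> I"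
      by (rule ideal_mult)
  qed
  finally show ?thesis .
qed

lemma ring_ideal_self: "ring_ideal R R"
  by unfold_locales (auto intro: ring_one ring_minus ring_add ring_mult ring_zero)

text \<open>The pair is \<open>R[X]\<close> and \<open>I[X]\<close>. With this instance,
  coefficientwise congruences of polynomials become instances of the general facts on
  ideals.\<close>

lemma ring_ideal_poly:
  "ring_ideal {p. \<forall>i. Polynomial.coeff p i \<in> R} {p. \<forall>i. Polynomial.coeff p i \<in> I}"
proof
  show "1 \<in> {p. \<forall>i. Polynomial.coeff p i \<in> R}"
    by (auto simp: Polynomial.coeff_1 ring_one ring_zero)
next
  show "{p. \<forall>i. Polynomial.coeff p i \<in> I} \<subseteq> {p. \<forall>i. Polynomial.coeff p i \<in> R}"
    using ideal_subset by blast
qed (auto simp: coeff_mult ideal_zero intro!: ring_minus ring_add ring_sum ring_mult ideal_sum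
    ideal_add ideal_mult)

text \<open>Every term in the binomial expansion of \<open>(x + y) ^ (m + n)\<close> is a multiple
  of \<open>x ^ m\<close> or of \<open>y ^ n\<close>. Admitting the exponent \<open>0\<close> does
  no harm, since \<open>1 \<in> I\<close> means \<open>I = R\<close>.\<close>

lemma ring_ideal_radical: "ring_ideal R {x \<in> R. \<exists>n. x ^ n \<in> I}"
proof
  fix x y assume "x \<in> {x \<in> R. \<exists>n. x ^ n \<in> I}" "y \<in> {x \<in> R. \<exists>n. x ^ n \<in> I}"
  then obtain m n where x: "x \<in> R" "x ^ m \<in> I" and y: "y \<in> R" "y ^ n \<in> I"
    by blast
  have "of_nat ((m + n) choose k) * x ^ k * y ^ (m + n - k) \<in> I" if "k \<le> m + n" for k
  proof (cases "m \<le> k")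
    case True
    then show ?thesis
      using ideal_power_le[OF x True] y ideal_mult_right ideal_mult ring_power ring_of_nat by simp
  next
    case False
    then have "y ^ (m + n - k) \<in> I"
      using ideal_power_le[OF y, of "m + n - k"] by simp
    then show ?thesis
      using x by (intro ideal_mult ring_mult ring_power ring_of_nat)
  qed
  then have "(x + y) ^ (m + n) \<in> I"
    by (auto simp: binomial_ring intro!: ideal_sum)
  then show "x + y \<in> {x \<in> R. \<exists>n. x ^ n \<in> I}"
    using x y ring_add by blast
next
  fix r x assume r: "r \<in> R" and x: "x \<in> {x \<in> R. \<exists>n. x ^ n \<in> I}"
  then show "r * x \<in> {x \<in> R. \<exists>n. x ^ n \<in> I}"
    by (auto simp: power_mult_distrib intro!: ring_mult) (meson ideal_mult ring_power)
next
  have "0 ^ 1 \<in> I"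
    by (simp add: ideal_zero)
  then show "0 \<in> {x \<in> R. \<exists>n. x ^ n \<in> I}"
    using ring_zero by blast
qed (auto intro: ring_one ring_minus ring_add ring_mult)

end

section \<open>Integrality over an ideal\<close>

text \<open>The leading coefficient \<open>1\<close> is exempt from membership in \<open>I\<close>,
  and the lower ones are taken from \<open>I\<close> itself, not from its powers. With a subring in
  the place of \<open>I\<close> this is ordinary integrality.\<close>

definition integral_wrt :: "'a::comm_ring_1 set \<Rightarrow> 'a \<Rightarrow> bool" where
  "integral_wrt I x \<longleftrightarrow> (\<exists>p. Polynomial.lead_coeff p = 1
     \<and> (\<forall>i < Polynomial.degree p. Polynomial.coeff p i \<in> I) \<and> poly p x = 0)"

lemma (in ring_ideal) integral_wrt_iff: "integral_wrt R x \<longleftrightarrow> integral_over R x"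
proof -
  have "(\<forall>i < Polynomial.degree p. Polynomial.coeff p i \<in> R) \<longleftrightarrow> (\<forall>i. Polynomial.coeff p i \<in> R)"
    if "Polynomial.lead_coeff p = 1" for p :: "'a poly"
    using that by (metis coeff_eq_0 linorder_neqE_nat ring_one ring_zero)
  then show ?thesis
    unfolding integral_wrt_def integral_over_def by blast
qed

lemma integral_wrtE:
  assumes "integral_wrt I x"
  obtains n c where "\<And>i. i < n \<Longrightarrow> c i \<in> I" "x ^ n = - (\<Sum>i<n. c i * x ^ i)"
proof -
  obtain p where p: "Polynomial.lead_coeff p = 1"
    "\<And>i. i < Polynomial.degree p \<Longrightarrow> Polynomial.coeff p i \<in> I" "poly p x = 0"
    using assms unfolding integral_wrt_def by blast
  have "(\<Sum>i<Polynomial.degree p. Polynomial.coeff p i * x ^ i) + x ^ Polynomial.degree p = 0"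
    using p(1,3) by (simp add: poly_altdef lessThan_Suc_atMost[symmetric])
  then have "x ^ Polynomial.degree p = - (\<Sum>i<Polynomial.degree p. Polynomial.coeff p i * x ^ i)"
    by (simp add: eq_neg_iff_add_eq_0 add.commute)
  with p(2) show ?thesis
    by (rule that)
qed

section \<open>Spans \<open>I M\<close> of finitely generated modules \<open>M\<close>, and the
  determinant trick\<close>

definition ideal_span :: "'a::comm_ring_1 set \<Rightarrow> 'a set \<Rightarrow> 'a set" where
  "ideal_span I B = {\<Sum>b\<in>B. c b * b | c. \<forall>b\<in>B. c b \<in> I}"

context ring_ideal
begin

lemma ideal_span_base:
  assumes "finite B" "b \<in> B" "a \<in> I"
  shows "a * b \<in> ideal_span I B"
proof -
  have "a * b = (\<Sum>b'\<in>B. (if b' = b then a else 0) * b')"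
    using assms by (simp add: if_distrib[of "\<lambda>x. x * _"] cong: if_cong)
  then show ?thesis
    unfolding ideal_span_def using assms ideal_zero
    by (intro CollectI exI[of _ "\<lambda>b'. if b' = b then a else 0"]) auto
qed

lemma ideal_span_zero: "0 \<in> ideal_span I B"
  unfolding ideal_span_def using ideal_zero by (intro CollectI exI[of _ "\<lambda>_. 0"]) auto

lemma ideal_span_add:
  assumes "x \<in> ideal_span I B" "y \<in> ideal_span I B"
  shows "x + y \<in> ideal_span I B"
proof -
  obtain c d where "x = (\<Sum>b\<in>B. c b * b)" "\<forall>b\<in>B. c b \<in> I"
    "y = (\<Sum>b\<in>B. d b * b)" "\<forall>b\<in>B. d b \<in> I"
    using assms unfolding ideal_span_def by blast
  then have "x + y = (\<Sum>b\<in>B. (c b + d b) * b)" "\<forall>b\<in>B. c b + d b \<in> I"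
    by (auto simp: distrib_right sum.distrib ideal_add)
  then show ?thesis
    unfolding ideal_span_def by (intro CollectI exI[of _ "\<lambda>b. c b + d b"]) auto
qed

lemma ideal_span_sum: "(\<And>x. x \<in> A \<Longrightarrow> f x \<in> ideal_span I B) \<Longrightarrow> sum f A \<in> ideal_span I B"
  by (induction A rule: infinite_finite_induct) (auto intro: ideal_span_zero ideal_span_add)

lemma ideal_span_mult:
  assumes "a \<in> I" "x \<in> ideal_span R B"
  shows "a * x \<in> ideal_span I B"
proof -
  obtain c where c: "x = (\<Sum>b\<in>B. c b * b)" "\<forall>b\<in>B. c b \<in> R"
    using assms(2) unfolding ideal_span_def by blast
  then have "a * x = (\<Sum>b\<in>B. (a * c b) * b)" "\<forall>b\<in>B. a * c b \<in> I"
    using assms(1) by (auto simp: sum_distrib_left mult.assoc ideal_mult_right)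
  then show ?thesis
    unfolding ideal_span_def by (intro CollectI exI[of _ "\<lambda>b. a * c b"]) auto
qed

lemma mult_ideal_span:
  assumes "\<And>b. b \<in> B \<Longrightarrow> y * b \<in> ideal_span I C" "x \<in> ideal_span R B"
  shows "y * x \<in> ideal_span I C"
proof -
  interpret RR: ring_ideal R R
    by (rule ring_ideal_self)
  obtain c where c: "x = (\<Sum>b\<in>B. c b * b)" "\<forall>b\<in>B. c b \<in> R"
    using assms(2) unfolding ideal_span_def by blast
  have "r * w \<in> ideal_span I C" if "r \<in> R" "w \<in> ideal_span I C" for r w
  proof -
    obtain d where d: "w = (\<Sum>b\<in>C. d b * b)" "\<forall>b\<in>C. d b \<in> I"
      using \<open>w \<in> _\<close> unfolding ideal_span_def by blast
    then have "r * w = (\<Sum>b\<in>C. (r * d b) * b)" "\<forall>b\<in>C. r * d b \<in> I"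
      using that(1) by (auto simp: sum_distrib_left mult.assoc ideal_mult)
    then show ?thesis
      unfolding ideal_span_def by (intro CollectI exI[of _ "\<lambda>b. r * d b"]) auto
  qed
  then have "(\<Sum>b\<in>B. c b * (y * b)) \<in> ideal_span I C"
    using assms(1) c(2) by (intro ideal_span_sum) auto
  then show ?thesis
    unfolding c(1) by (simp add: sum_distrib_left mult.left_commute)
qed

end

text \<open>Determinant trick: the generators form an eigenvector, with eigenvalue \<open>x\<close>,
  of a matrix with entries in \<open>I\<close>. So \<open>x\<close> is a root of its characteristic
  polynomial, which is congruent to \<open>X ^ n\<close> modulo \<open>I\<close>.\<close>

lemma integral_wrt_if_stable_span:
  fixes R I :: "'a::field set"
  assumes "ring_ideal R I"
    and B: "finite B" "1 \<in> B" and stable: "\<And>b. b \<in> B \<Longrightarrow> x * b \<in> ideal_span I B"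
  shows "integral_wrt I x"
proof -
  interpret ring_ideal R I by fact
  interpret poly: ring_ideal "{p. \<forall>i. Polynomial.coeff p i \<in> R}" "{p. \<forall>i. Polynomial.coeff p i \<in> I}"
    by (rule ring_ideal_poly)
  obtain bs where bs: "set bs = B" "distinct bs"
    using finite_distinct_list[OF B(1)] by blast
  define n where "n = length bs"
  have "\<forall>b\<in>B. \<exists>c. x * b = (\<Sum>b'\<in>B. c b' * b') \<and> (\<forall>b'\<in>B. c b' \<in> I)"
    using stable unfolding ideal_span_def by blast
  then obtain c where c: "\<And>b. b \<in> B \<Longrightarrow> x * b = (\<Sum>b'\<in>B. c b b' * b')"
    "\<And>b b'. b \<in> B \<Longrightarrow> b' \<in> B \<Longrightarrow> c b b' \<in> I"
    by metis
  define A where "A = mat n n (\<lambda>(i, j). c (bs ! i) (bs ! j))"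
  have A: "A \<in> carrier_mat n n"
    by (simp add: A_def)
  have mem: "bs ! i \<in> B" if "i < n" for i
    using that bs n_def by auto
  have AI: "A $$ (i, j) \<in> I" if "i < n" "j < n" for i j
    using that c(2) mem by (simp add: A_def)
  have "eigenvector A (vec n ((!) bs)) x"
    unfolding eigenvector_def
  proof (intro conjI)
    show "vec n ((!) bs) \<in> carrier_vec (dim_row A)"
      using A by simp
    \<comment> \<open>The generator \<open>1\<close> makes the eigenvector nonzero.\<close>
    obtain i where "i < n" "bs ! i = 1"
      using B(2) bs n_def by (metis in_set_conv_nth)
    then have "vec n ((!) bs) $ i \<noteq> 0\<^sub>v n $ i"
      by simp
    then show "vec n ((!) bs) \<noteq> 0\<^sub>v (dim_row A)"
      using A by auto
    show "A *\<^sub>v vec n ((!) bs) = x \<cdot>\<^sub>v vec n ((!) bs)"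
    proof (rule eq_vecI)
      fix i assume "i < dim_vec (x \<cdot>\<^sub>v vec n ((!) bs))"
      then have i: "i < n" by simp
      have "(\<Sum>j = 0..<n. c (bs ! i) (bs ! j) * bs ! j) = (\<Sum>b'\<in>B. c (bs ! i) b' * b')"
        using bs by (intro sum.reindex_bij_betw bij_betw_nth) (auto simp: n_def)
      then show "(A *\<^sub>v vec n ((!) bs)) $ i = (x \<cdot>\<^sub>v vec n ((!) bs)) $ i"
        using i A c(1)[OF mem[OF i]] by (simp add: A_def scalar_prod_def)
    qed (use A in simp)
  qed
  then have root: "poly (char_poly A) x = 0"
    using eigenvalue_root_char_poly[OF A] unfolding eigenvalue_def by blast
  have deg: "Polynomial.degree (char_poly A) = n" "Polynomial.coeff (char_poly A) n = 1"
    using degree_monic_char_poly[OF A] by auto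
  \<comment> \<open>\<open>?X\<close> is \<open>X\<close> times the identity matrix. The
    characteristic matrix differs from it by entries in \<open>I[X]\<close>, so the two determinants
    agree modulo \<open>I[X]\<close>.\<close>
  let ?X = "[:0, 1:] \<cdot>\<^sub>m 1\<^sub>m n :: 'a poly mat"
  have "det (char_poly_matrix A) - det ?X \<in> {p. \<forall>i. Polynomial.coeff p i \<in> I}"
  proof (rule poly.det_cong_ideal)
    fix i j assume ij: "i < n" "j < n"
    have "- A $$ (i, j) \<in> I"
      using AI[OF ij] by (rule ideal_minus)
    then show diff: "char_poly_matrix A $$ (i, j) - ?X $$ (i, j) \<in> {p. \<forall>i. Polynomial.coeff p i \<in> I}"
      using ij A by (auto simp: char_poly_matrix_def coeff_pCons ideal_zero split: nat.split)
    show X: "?X $$ (i, j) \<in> {p. \<forall>i. Polynomial.coeff p i \<in> R}"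
      using ij by (auto simp: coeff_pCons ring_zero ring_one split: nat.split)
    show "char_poly_matrix A $$ (i, j) \<in> {p. \<forall>i. Polynomial.coeff p i \<in> R}"
      using poly.ring_add[OF poly.ideal_in_ring[OF diff] X] by simp
  qed (use A in simp_all)
  moreover have "det ?X = Polynomial.monom 1 n"
    by (simp add: Polynomial.monom_altdef)
  ultimately have "Polynomial.coeff (char_poly A) i \<in> I" if "i < n" for i
    using that by (auto simp: char_poly_def dest: spec[of _ i])
  then show ?thesis
    unfolding integral_wrt_def using deg root by (intro exI[of _ "char_poly A"]) auto
qed

text \<open>The integral elements are adjoined one at a time: the generators found so far are
  multiplied by powers of the new element \<open>s\<close>, whose monic equation bounds the powers
  that are required.\<close>

lemma (in ring_ideal) stable_span_exists:
  assumes "finite T" "\<forall>t\<in>T. integral_wrt R t"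
  shows "\<exists>B. finite B \<and> 1 \<in> B \<and> (\<forall>t\<in>T. \<forall>b\<in>B. t * b \<in> ideal_span R B)"
  using assms
proof (induction T rule: finite_induct)
  case empty
  then show ?case
    by (intro exI[of _ "{1}"]) auto
next
  case (insert s T)
  interpret RR: ring_ideal R R
    by (rule ring_ideal_self)
  obtain B where B: "finite B" "1 \<in> B" "\<And>t b. t \<in> T \<Longrightarrow> b \<in> B \<Longrightarrow> t * b \<in> ideal_span R B"
    using insert by blast
  obtain n c where c: "\<And>i. i < n \<Longrightarrow> c i \<in> R" and sn: "s ^ n = - (\<Sum>i<n. c i * s ^ i)"
    using insert.prems integral_wrtE[of R s] by blast
  \<comment> \<open>Keeping the exponent \<open>n\<close> as well ensures \<open>1 \<in> B'\<close>
    without a separate treatment of \<open>n = 0\<close>.\<close>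
  define B' where "B' = (\<lambda>(b, i). b * s ^ i) ` (B \<times> {..n})"
  have fin: "finite B'"
    using B(1) by (simp add: B'_def)
  have "1 * s ^ 0 \<in> B'"
    unfolding B'_def using B(2) by (force intro: image_eqI[of _ _ "(1, 0)"])
  then have one: "1 \<in> B'"
    by simp
  have mem: "a * (b * s ^ i) \<in> ideal_span R B'" if "a \<in> R" "b \<in> B" "i \<le> n" for a b i
    using that fin unfolding B'_def by (intro RR.ideal_span_base) force+
  have "t * b' \<in> ideal_span R B'" if t: "t \<in> insert s T" and "b' \<in> B'" for t b'
  proof -
    obtain b i where b: "b \<in> B" and i: "i \<le> n" and b': "b' = b * s ^ i"
      using \<open>b' \<in> B'\<close> unfolding B'_def by auto
    consider "t \<in> T" | "t = s" "i < n" | "t = s" "i = n"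
      using t i by fastforce
    then show ?thesis
    proof cases
      case 1
      have "s ^ i * b'' \<in> ideal_span R B'" if "b'' \<in> B" for b''
        using mem[OF ring_one that i] by (simp add: mult.commute)
      then have "s ^ i * (t * b) \<in> ideal_span R B'"
        using B(3)[OF 1 b] by (rule RR.mult_ideal_span)
      then show ?thesis
        by (simp add: b' mult_ac)
    next
      case 2
      then show ?thesis
        using mem[OF ring_one b, of "Suc i"] by (simp add: b' mult_ac)
    next
      case 3
      \<comment> \<open>Here the exponent overflows. Replacing \<open>s ^ n\<close> by the lower
        powers leaves exponents \<open>Suc i\<close>, which are at most \<open>n\<close>
        again.\<close>
      have "t * b' = s * b * s ^ n"
        using 3 by (simp add: b' mult.assoc)
      also have "\<dots> = (\<Sum>i<n. (- c i) * (b * s ^ Suc i))"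
        unfolding sn by (simp add: sum_distrib_left sum_negf mult_ac)
      also have "\<dots> \<in> ideal_span R B'"
        using b c by (intro RR.ideal_span_sum mem ring_minus) auto
      finally show ?thesis .
    qed
  qed
  with fin one show ?case
    by blast
qed

text \<open>The extended ideal \<open>I S\<close>, built one summand at a time so that its elements
  admit induction. Lemma \<open>genideal_ring_on\<close> identifies it with the generated
  ideal.\<close>

inductive_set ideal_ext :: "'a::comm_ring_1 set \<Rightarrow> 'a set \<Rightarrow> 'a set" for S I where
  zero: "0 \<in> ideal_ext S I"
| step: "a \<in> I \<Longrightarrow> s \<in> S \<Longrightarrow> w \<in> ideal_ext S I \<Longrightarrow> a * s + w \<in> ideal_ext S I"

lemma ideal_ext_base: "a \<in> I \<Longrightarrow> s \<in> S \<Longrightarrow> a * s \<in> ideal_ext S I"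
  using ideal_ext.step[OF _ _ ideal_ext.zero] by fastforce

lemma ideal_ext_add: "x \<in> ideal_ext S I \<Longrightarrow> y \<in> ideal_ext S I \<Longrightarrow> x + y \<in> ideal_ext S I"
  by (induction x rule: ideal_ext.induct) (auto simp: add.assoc intro: ideal_ext.step)

lemma ideal_ext_mono: "x \<in> ideal_ext S I \<Longrightarrow> S \<subseteq> S' \<Longrightarrow> I \<subseteq> I' \<Longrightarrow> x \<in> ideal_ext S' I'"
  by (induction x rule: ideal_ext.induct) (auto intro: ideal_ext.intros)

lemma (in ring_ideal) ring_ideal_ext:
  assumes "J \<subseteq> R"
  shows "ring_ideal R (ideal_ext R J)"
proof
  have "w \<in> R" if "w \<in> ideal_ext R J" for w
    using that by induction (use assms in \<open>auto intro: ring_zero ring_add ring_mult\<close>)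
  then show "ideal_ext R J \<subseteq> R"
    by blast
next
  fix r w assume r: "r \<in> R" and w: "w \<in> ideal_ext R J"
  from w show "r * w \<in> ideal_ext R J"
  proof induction
    case (step a s w)
    have "r * (a * s + w) = a * (r * s) + r * w"
      by (simp add: algebra_simps)
    then show ?case
      using step r by (auto intro: ideal_ext.step ring_mult)
  qed (simp add: ideal_ext.zero)
qed (auto intro: ring_one ring_minus ring_add ring_mult ideal_ext.zero ideal_ext_add)

section \<open>The integral closure of \<open>R\<close> in a field and the extension of
  \<open>I\<close> to it\<close>

locale ring_ideal_in_field = ring_ideal R I for R I :: "'a::field set"
begin

text \<open>Only finitely many integral elements occur in \<open>w\<close>. A finitely generated
  module \<open>M\<close> stable under all of them is sent into \<open>I M\<close> by
  \<open>w\<close>, so the determinant trick applies.\<close>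

lemma integral_wrt_if_ideal_ext:
  assumes "w \<in> ideal_ext {x. integral_wrt R x} I"
  shows "integral_wrt I w"
proof -
  \<comment> \<open>\<open>T\<close> collects the integral factors of the summands of
    \<open>w\<close>. The claim ranges over all \<open>B\<close> because a suitable \<open>B\<close>
    can be chosen only when \<open>T\<close> is complete.\<close>
  from assms have "\<exists>T. finite T \<and> (\<forall>t\<in>T. integral_wrt R t) \<and>
    (\<forall>B. (\<forall>t\<in>T. \<forall>b\<in>B. t * b \<in> ideal_span R B) \<longrightarrow> (\<forall>b\<in>B. w * b \<in> ideal_span I B))"
  proof induction
    case zero
    then show ?case
      by (intro exI[of _ "{}"]) (auto intro: ideal_span_zero)
  next
    case (step a s w)
    then obtain T where T: "finite T" "\<forall>t\<in>T. integral_wrt R t"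
      "\<And>B. (\<forall>t\<in>T. \<forall>b\<in>B. t * b \<in> ideal_span R B) \<Longrightarrow> (\<forall>b\<in>B. w * b \<in> ideal_span I B)"
      by blast
    have "(a * s + w) * b \<in> ideal_span I B"
      if "\<forall>t\<in>insert s T. \<forall>b\<in>B. t * b \<in> ideal_span R B" "b \<in> B" for b B
    proof -
      have "a * (s * b) \<in> ideal_span I B"
        using step(1) that by (intro ideal_span_mult) auto
      moreover have "w * b \<in> ideal_span I B"
        using T(3) that by auto
      ultimately show ?thesis
        by (simp add: distrib_right mult.assoc ideal_span_add)
    qed
    then show ?case
      using T(1,2) step(2) by (intro exI[of _ "insert s T"]) auto
  qed
  then obtain T where T: "finite T" "\<forall>t\<in>T. integral_wrt R t"
    "\<And>B. (\<forall>t\<in>T. \<forall>b\<in>B. t * b \<in> ideal_span R B) \<Longrightarrow> (\<forall>b\<in>B. w * b \<in> ideal_span I B)"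
    by blast
  obtain B where "finite B" "1 \<in> B" "\<forall>t\<in>T. \<forall>b\<in>B. t * b \<in> ideal_span R B"
    using stable_span_exists[OF T(1,2)] by blast
  with T(3)[of B] show ?thesis
    by (intro integral_wrt_if_stable_span[OF ring_ideal_axioms]) auto
qed

lemma integral_wrt_base:
  assumes "r \<in> R"
  shows "integral_wrt R r"
  unfolding integral_wrt_def using assms
  by (intro exI[of _ "[:- r, 1:]"]) (auto intro: ring_minus)

text \<open>A finite span that is stable under \<open>x\<close> and \<open>y\<close> is stable under
  \<open>x + y\<close> and \<open>x * y\<close>, so the determinant trick with \<open>I = R\<close>
  applies to both.\<close>

lemma ring_ideal_integral_closure: "ring_ideal {x. integral_wrt R x} {x. integral_wrt R x}"
proof -
  interpret RR: ring_ideal R R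
    by (rule ring_ideal_self)
  have stable: "\<exists>B. finite B \<and> 1 \<in> B \<and> (\<forall>b\<in>B. x * b \<in> ideal_span R B) \<and> (\<forall>b\<in>B. y * b \<in> ideal_span R B)"
    if "integral_wrt R x" "integral_wrt R y" for x y
    using stable_span_exists[of "{x, y}"] that by simp
  have add: "integral_wrt R (x + y)" and mult: "integral_wrt R (x * y)"
    if "integral_wrt R x" "integral_wrt R y" for x y
  proof -
    note xy = that
    obtain B where B: "finite B" "1 \<in> B" "\<And>b. b \<in> B \<Longrightarrow> x * b \<in> ideal_span R B"
      "\<And>b. b \<in> B \<Longrightarrow> y * b \<in> ideal_span R B"
      using stable[OF xy] by blast
    show "integral_wrt R (x + y)"
      using B by (intro integral_wrt_if_stable_span[OF ring_ideal_self B(1,2)])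
        (simp add: distrib_right RR.ideal_span_add)
    have "x * (y * b) \<in> ideal_span R B" if "b \<in> B" for b
      using B(3) B(4)[OF that] by (rule RR.mult_ideal_span)
    then show "integral_wrt R (x * y)"
      by (intro integral_wrt_if_stable_span[OF ring_ideal_self B(1,2)]) (simp add: mult.assoc)
  qed
  have minus: "integral_wrt R (- x)" if "integral_wrt R x" for x
    using mult[OF integral_wrt_base[OF ring_minus[OF ring_one]] that] by simp
  show ?thesis
    by unfold_locales (simp_all add: add mult minus integral_wrt_base ring_one ring_zero)
qed

end

text \<open>Modulo \<open>I[X]\<close> every factor is \<open>X\<close>, so the product is congruent
  to the monomial of degree \<open>size A\<close>.\<close>

lemma (in ring_ideal) coeff_prod_linear_in_ideal:
  assumes "\<forall>x\<in>#A. x \<in> I"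
  shows "i < size A \<Longrightarrow> Polynomial.coeff (\<Prod>x\<in>#A. [:- x, 1:]) i \<in> I"
proof -
  interpret poly: ring_ideal "{p. \<forall>i. Polynomial.coeff p i \<in> R}" "{p. \<forall>i. Polynomial.coeff p i \<in> I}"
    by (rule ring_ideal_poly)
  have "(\<Prod>x\<in>#A. [:- x, 1:]) - Polynomial.monom 1 (size A) \<in> {p. \<forall>i. Polynomial.coeff p i \<in> I}"
    using assms
  proof (induction A)
    case (add a A)
    have lin: "[:- a, 1:] \<in> {p. \<forall>i. Polynomial.coeff p i \<in> R}"
      using add.prems by (auto simp: coeff_pCons ring_zero ring_one ring_minus ideal_in_ring split: nat.split)
    have "Polynomial.monom (- a) (size A) \<in> {p. \<forall>i. Polynomial.coeff p i \<in> I}"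
      using add.prems by (auto simp: ideal_zero ideal_minus)
    moreover have "[:- a, 1:] * ((\<Prod>x\<in>#A. [:- x, 1:]) - Polynomial.monom 1 (size A))
        \<in> {p. \<forall>i. Polynomial.coeff p i \<in> I}"
      using add by (intro poly.ideal_mult[OF lin]) auto
    moreover have "(\<Prod>x\<in>#add_mset a A. [:- x, 1:]) - Polynomial.monom 1 (size (add_mset a A))
      = [:- a, 1:] * ((\<Prod>x\<in>#A. [:- x, 1:]) - Polynomial.monom 1 (size A)) + Polynomial.monom (- a) (size A)"
      by (simp add: algebra_simps Polynomial.monom_Suc smult_monom)
    ultimately show ?case
      by (simp only: poly.ideal_add)
  qed (simp add: ideal_zero)
  then show "Polynomial.coeff (\<Prod>x\<in>#A. [:- x, 1:]) i \<in> I" if "i < size A"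
    using that by (auto dest: spec[of _ i])
qed

text \<open>If \<open>g\<close> is the product with roots \<open>x\<close> and \<open>d\<close> its
  degree, the product with roots \<open>u * x\<close> is \<open>u ^ d * g(X / u)\<close>.\<close>

lemma coeff_prod_linear_scale:
  fixes u :: "'a::field"
  assumes "i \<le> size A" "u \<noteq> 0"
  shows "Polynomial.coeff (\<Prod>x\<in>#A. [:- (u * x), 1:]) i
    = u ^ (size A - i) * Polynomial.coeff (\<Prod>x\<in>#A. [:- x, 1:]) i"
proof -
  have "(\<Prod>x\<in>#A. [:- (u * x), 1:])
      = Polynomial.smult (u ^ size A) (pcompose (\<Prod>x\<in>#A. [:- x, 1:]) [:0, inverse u:])"
  proof (induction A)
    case (add a A)
    have "(\<Prod>x\<in>#add_mset a A. [:- (u * x), 1:])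
        = [:- (u * a), 1:] * (\<Prod>x\<in>#A. [:- (u * x), 1:])"
      by (simp only: image_mset_add_mset prod_mset.add_mset)
    also have "[:- (u * a), 1:] = Polynomial.smult u (pcompose [:- a, 1:] [:0, inverse u:])"
      using assms(2) by (simp add: pcompose_pCons)
    finally show ?case
      unfolding add.IH image_mset_add_mset prod_mset.add_mset pcompose_mult
        mult_smult_left mult_smult_right smult_smult size_add_mset power_Suc2 .
  qed (simp add: pcompose_1)
  moreover have "u ^ size A * inverse u ^ i = u ^ (size A - i)"
    using assms by (simp add: power_diff power_inverse divide_inverse)
  ultimately show ?thesis
    by (simp add: coeff_pcompose_linear)
qed

section \<open>Contraction from an integral extension\<close>

text \<open>Division by the minimal polynomial of \<open>z\<close> over a subfield \<open>K\<close>
  given as a set: leading terms of \<open>f\<close> are cancelled by multiples of \<open>g\<close>,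
  and all intermediate polynomials keep their coefficients in \<open>K\<close>.\<close>

lemma poly_vanish_min_dvd:
  fixes K :: "'a::field set"
  assumes K: "ring_ideal K K" "\<And>a. a \<in> K \<Longrightarrow> inverse a \<in> K"
    and g: "Polynomial.lead_coeff g = 1" "\<And>i. Polynomial.coeff g i \<in> K" "poly g z = 0"
    and min: "\<And>h. Polynomial.lead_coeff h = 1 \<Longrightarrow> (\<And>i. Polynomial.coeff h i \<in> K) \<Longrightarrow> poly h z = 0
      \<Longrightarrow> Polynomial.degree g \<le> Polynomial.degree h"
    and f: "\<And>i. Polynomial.coeff f i \<in> K" "poly f z = 0"
  shows "g dvd f"
  using f
proof (induction "Polynomial.degree f" arbitrary: f rule: less_induct)
  case less
  interpret K: ring_ideal K K by fact
  interpret P: ring_ideal "{p. \<forall>i. Polynomial.coeff p i \<in> K}" "{p. \<forall>i. Polynomial.coeff p i \<in> K}"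
    by (rule K.ring_ideal_poly)
  let ?c = "Polynomial.lead_coeff f"
  show ?case
  proof (cases "f = 0")
    case False
    \<comment> \<open>Normalising \<open>f\<close> to a monic polynomial makes the minimality of
      \<open>g\<close> applicable.\<close>
    let ?h = "Polynomial.smult (inverse ?c) f"
    have "Polynomial.degree g \<le> Polynomial.degree ?h"
      using less.prems False K by (intro min) (auto intro: K.ring_mult)
    then have deg: "Polynomial.degree g \<le> Polynomial.degree f"
      using False by simp
    define q where "q = Polynomial.monom ?c (Polynomial.degree f - Polynomial.degree g)"
    have q: "q \<noteq> 0" "Polynomial.degree q = Polynomial.degree f - Polynomial.degree g"
      "Polynomial.lead_coeff q = ?c"
      using False by (simp_all add: q_def degree_monom_eq)
    have g0: "g \<noteq> 0"
      using g(1) by auto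
    have degqg: "Polynomial.degree (q * g) = Polynomial.degree f"
      using q g0 deg by (simp add: degree_mult_eq)
    have lc: "Polynomial.lead_coeff (q * g) = ?c"
      using g(1) q(3) by (simp add: lead_coeff_mult)
    have "q * g \<in> {p. \<forall>i. Polynomial.coeff p i \<in> K}"
      using g(2) less.prems(1) by (intro P.ring_mult) (auto simp: q_def K.ring_zero)
    then have fq: "f - q * g \<in> {p. \<forall>i. Polynomial.coeff p i \<in> K}"
      using less.prems(1) by (intro P.ideal_diff) auto
    have "g dvd f - q * g"
    proof (cases "f - q * g = 0")
      case nz: False
      have "Polynomial.degree (f - q * g) \<noteq> Polynomial.degree f"
        using nz lc degqg by (metis cancel_comm_monoid_add_class.diff_cancel coeff_diff leading_coeff_0_iff)
      moreover have "Polynomial.degree (f - q * g) \<le> Polynomial.degree f"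
        using degqg degree_diff_le_max[of f "q * g"] by simp
      ultimately have "Polynomial.degree (f - q * g) < Polynomial.degree f"
        by simp
      then show ?thesis
        using fq less.prems(2) g(3) by (intro less.hyps) auto
    qed simp
    then have "g dvd (f - q * g) + q * g"
      by (intro dvd_add) auto
    then show ?thesis by simp
  qed simp
qed

lemma (in ring_ideal_in_field) fractions_field:
  defines "K \<equiv> {a / b |a b. a \<in> R \<and> b \<in> R \<and> b \<noteq> 0}"
  shows "ring_ideal K K" and "R \<subseteq> K" and "\<And>x. x \<in> K \<Longrightarrow> inverse x \<in> K"
proof -
  have frac: "a / b \<in> K" if "a \<in> R" "b \<in> R" "b \<noteq> 0" for a b
    unfolding K_def using that by blast
  show R: "R \<subseteq> K"
    using frac[OF _ ring_one] by auto
  show "inverse x \<in> K" if x: "x \<in> K" for x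
  proof -
    obtain a b where ab: "x = a / b" "a \<in> R" "b \<in> R" "b \<noteq> 0"
      using x unfolding K_def by blast
    then show ?thesis
      using frac[of b a] R ring_zero by (cases "a = 0") auto
  qed
  have add: "x + y \<in> K" and mult: "x * y \<in> K" if "x \<in> K" "y \<in> K" for x y
  proof -
    from that obtain a b c d where x: "x = a / b" "a \<in> R" "b \<in> R" "b \<noteq> 0"
      and y: "y = c / d" "c \<in> R" "d \<in> R" "d \<noteq> 0"
      unfolding K_def by blast
    have "x + y = (a * d + c * b) / (b * d)"
      using x y by (simp add: field_simps)
    then show "x + y \<in> K"
      using x y by (auto intro!: frac ring_add ring_mult)
    have "x * y = (a * c) / (b * d)"
      using x y by simp
    then show "x * y \<in> K"
      using x y by (auto intro!: frac ring_mult simp del: times_divide_times_eq)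
  qed
  have minus: "- x \<in> K" if "x \<in> K" for x
  proof -
    from that obtain a b where x: "x = a / b" "a \<in> R" "b \<in> R" "b \<noteq> 0"
      unfolding K_def by blast
    then show ?thesis
      using frac[of "- a" b] by (auto intro: ring_minus)
  qed
  show "ring_ideal K K"
    using R ring_one ring_zero by unfold_locales (auto simp: add mult minus)
qed

text \<open>The equation of \<open>x\<close> over \<open>I\<close> writes \<open>x ^ n\<close> as a
  combination of integral elements \<open>x ^ i\<close> with coefficients in
  \<open>I\<close>.\<close>

lemma (in ring_ideal_in_field) pow_in_ideal_ext:
  assumes "integral_wrt I x" and "integral_wrt R x"
  shows "\<exists>n. x ^ n \<in> ideal_ext {x. integral_wrt R x} I"
proof -
  interpret S: ring_ideal "{x. integral_wrt R x}" "{x. integral_wrt R x}"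
    by (rule ring_ideal_integral_closure)
  interpret IS: ring_ideal "{x. integral_wrt R x}" "ideal_ext {x. integral_wrt R x} I"
    using integral_wrt_base ideal_in_ring by (intro S.ring_ideal_ext) auto
  obtain n c where c: "\<And>i. i < n \<Longrightarrow> c i \<in> I" and "x ^ n = - (\<Sum>i<n. c i * x ^ i)"
    using assms(1) by (rule integral_wrtE) blast
  then have "x ^ n \<in> ideal_ext {x. integral_wrt R x} I"
    using S.ring_power[of x] assms(2)
    by (auto intro!: IS.ideal_minus IS.ideal_sum ideal_ext_base)
  then show ?thesis ..
qed

text \<open>The element \<open>a ^ m\<close> is integral over \<open>I\<close>. All terms of its
  equation lie in \<open>R\<close>, so a power of \<open>a\<close> lies in \<open>I\<close> and the
  radical hypothesis applies.\<close>

lemma (in ring_ideal_in_field) contraction_subset_radical: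
  assumes "\<And>a n. a \<in> R \<Longrightarrow> a ^ n \<in> I \<Longrightarrow> a \<in> I"
    and a: "a \<in> R" and ext: "a ^ m \<in> ideal_ext {x. integral_wrt R x} I"
  shows "a \<in> I"
proof -
  obtain n c where c: "\<And>i. i < n \<Longrightarrow> c i \<in> I"
    and n: "(a ^ m) ^ n = - (\<Sum>i<n. c i * (a ^ m) ^ i)"
    using integral_wrt_if_ideal_ext[OF ext] by (rule integral_wrtE) blast
  have "(a ^ m) ^ n \<in> I"
    unfolding n using c a by (intro ideal_minus ideal_sum ideal_mult_right ring_power) auto
  then have "a ^ (m * n) \<in> I"
    by (simp add: power_mult)
  with a assms(1) show ?thesis by blast
qed

text \<open>The minimal polynomial \<open>g\<close> of \<open>z\<close> over the fractions of
  \<open>R\<close> splits in the ambient field. The hypothesis \<open>closed\<close> brings its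
  coefficients into \<open>R\<close>, \<open>radical\<close> brings their multiples by powers of
  \<open>u\<close> into \<open>I\<close>, and \<open>cancel\<close> removes these powers.\<close>

lemma integral_wrt_cancel:
  fixes R I :: "'a::alg_closed_field set"
  assumes RI: "ring_ideal R I"
    and closed: "\<And>a b. a \<in> R \<Longrightarrow> b \<in> R \<Longrightarrow> b \<noteq> 0 \<Longrightarrow> integral_wrt R (a / b) \<Longrightarrow> a / b \<in> R"
    and radical: "\<And>a n. a \<in> R \<Longrightarrow> a ^ n \<in> I \<Longrightarrow> a \<in> I"
    and u: "u \<in> R" "u \<noteq> 0" and cancel: "\<And>a. a \<in> R \<Longrightarrow> u * a \<in> I \<Longrightarrow> a \<in> I"
    and z: "integral_wrt R z" and uz: "integral_wrt I (u * z)"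
  shows "integral_wrt I z"
proof -
  interpret ring_ideal_in_field R I
    using RI by (simp add: ring_ideal_in_field_def)
  let ?S = "{x. integral_wrt R x}"
  interpret S: ring_ideal ?S ?S
    by (rule ring_ideal_integral_closure)
  interpret IS: ring_ideal ?S "ideal_ext ?S I"
    using integral_wrt_base ideal_in_ring by (intro S.ring_ideal_ext) auto
  interpret rad: ring_ideal ?S "{x \<in> ?S. \<exists>n. x ^ n \<in> ideal_ext ?S I}"
    by (rule IS.ring_ideal_radical)
  define K where "K = {a / b |a b. a \<in> R \<and> b \<in> R \<and> b \<noteq> 0}"
  note K = fractions_field[folded K_def]
  interpret K: ring_ideal K K by (rule K(1))
  define P where "P = (\<lambda>g. Polynomial.lead_coeff g = 1 \<and> (\<forall>i. Polynomial.coeff g i \<in> K) \<and> poly g z = 0)"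
  obtain p where p: "Polynomial.lead_coeff p = 1" "\<And>i. Polynomial.coeff p i \<in> R" "poly p z = 0"
    using z unfolding integral_wrt_iff integral_over_def by blast
  then have "P p"
    using K(2) by (auto simp: P_def)
  then obtain g where g: "P g" and g_min: "\<And>h. P h \<Longrightarrow> Polynomial.degree g \<le> Polynomial.degree h"
    using exists_least_iff[of "\<lambda>n. \<exists>g. P g \<and> Polynomial.degree g = n"] by (metis not_le_imp_less)
  have g_dvd: "g dvd f" if "\<And>i. Polynomial.coeff f i \<in> K" "poly f z = 0" for f
    using K(1,3) g g_min that by (intro poly_vanish_min_dvd[of K g z f]) (auto simp: P_def)
  have "g \<noteq> 0"
    using g by (auto simp: P_def)
  then obtain A where size: "size A = Polynomial.degree g" and A: "g = (\<Prod>x\<in>#A. [:- x, 1:])"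
    using alg_closed_imp_factorization[of g] g by (auto simp: P_def)
  have root: "poly g x = 0" if "x \<in># A" for x
    unfolding A poly_prod_mset using that by (auto intro!: image_eqI[of _ _ x])
  have int_root: "integral_wrt R x" if "x \<in># A" for x
  proof -
    \<comment> \<open>The conjugates of \<open>z\<close> satisfy its integral equation
      \<open>p\<close>.\<close>
    have "g dvd p"
      using p K(2) by (intro g_dvd) auto
    then have "poly p x = 0"
      using root[OF that] by (auto simp: dvd_def)
    then show ?thesis
      unfolding integral_wrt_iff integral_over_def using p by blast
  qed
  have rad_root: "u * x \<in> {x \<in> ?S. \<exists>n. x ^ n \<in> ideal_ext ?S I}" if "x \<in># A" for x
  proof -
    obtain f where f: "Polynomial.lead_coeff f = 1"
      "\<And>i. i < Polynomial.degree f \<Longrightarrow> Polynomial.coeff f i \<in> I" "poly f (u * z) = 0"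
      using uz unfolding integral_wrt_def by blast
    have "Polynomial.coeff f i \<in> R" for i
      using f ideal_in_ring ring_zero ring_one
      by (cases i "Polynomial.degree f" rule: linorder_cases) (auto simp: coeff_eq_0)
    \<comment> \<open>\<open>pcompose f [:0, u:]\<close> is \<open>f(u X)\<close>. It vanishes at
      \<open>z\<close>, hence at every conjugate \<open>x\<close> of \<open>z\<close>, so
      \<open>u * x\<close> satisfies the equation of \<open>u * z\<close> over
      \<open>I\<close>.\<close>
    then have "g dvd pcompose f [:0, u:]"
      using f(3) u K(2) ring_mult ring_power
      by (intro g_dvd) (auto simp: coeff_pcompose_linear poly_pcompose mult.commute)
    then have "poly f (u * x) = 0"
      using root[OF that] by (auto simp: dvd_def poly_pcompose mult.commute dest: arg_cong[of _ _ "\<lambda>p. poly p x"])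
    then have "integral_wrt I (u * x)"
      unfolding integral_wrt_def using f by blast
    moreover have "integral_wrt R (u * x)"
      using S.ring_mult[of u x] integral_wrt_base[OF u(1)] int_root[OF that] by simp
    ultimately show ?thesis
      using pow_in_ideal_ext by simp
  qed
  have "Polynomial.coeff g i \<in> I" if i: "i < Polynomial.degree g" for i
  proof -
    \<comment> \<open>The coefficients of \<open>g\<close> are integral over \<open>R\<close>, being
      built from the roots, and they are fractions of elements of \<open>R\<close>.\<close>
    have "Polynomial.coeff g i \<in> ?S"
      unfolding A using int_root i size by (intro S.coeff_prod_linear_in_ideal) auto
    moreover have "Polynomial.coeff g i \<in> K"
      using g by (simp add: P_def)
    ultimately have R: "Polynomial.coeff g i \<in> R"
      unfolding K_def using closed by auto
    let ?a = "u ^ (size A - i) * Polynomial.coeff g i"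
    \<comment> \<open>Scaling the roots by \<open>u\<close> moves them into the radical and
      multiplies this coefficient by \<open>u ^ (size A - i)\<close>.\<close>
    have "Polynomial.coeff (\<Prod>x\<in>#image_mset ((*) u) A. [:- x, 1:]) i
        \<in> {x \<in> ?S. \<exists>n. x ^ n \<in> ideal_ext ?S I}"
      using rad_root i size by (intro rad.coeff_prod_linear_in_ideal) auto
    moreover have "Polynomial.coeff (\<Prod>x\<in>#image_mset ((*) u) A. [:- x, 1:]) i = ?a"
      using coeff_prod_linear_scale[of i A u] i size u by (simp add: A image_mset.compositionality o_def)
    ultimately obtain m where "?a ^ m \<in> ideal_ext ?S I"
      by auto
    moreover have "?a \<in> R"
      using u R by (intro ring_mult ring_power)
    ultimately have "?a \<in> I"
      using contraction_subset_radical radical by blast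
    moreover have "Polynomial.coeff g i \<in> I" if "u ^ k * Polynomial.coeff g i \<in> I" for k
      using that
    proof (induction k)
      case (Suc k)
      then show ?case
        using cancel[of "u ^ k * Polynomial.coeff g i"] u R by (auto simp: mult.assoc intro: ring_mult ring_power)
    qed simp
    ultimately show ?thesis
      by blast
  qed
  with g show ?thesis
    unfolding integral_wrt_def P_def by blast
qed

section \<open>Transfer to the algebraic closure of the fraction field\<close>

definition frac_closure :: "'a::idom \<Rightarrow> 'a fract alg_closure" where
  "frac_closure x = to_ac (to_fract x)"

interpretation to_ac: field_hom to_ac
  by unfold_locales simp_all

interpretation frac_closure: inj_comm_ring_hom frac_closure
  by unfold_locales (simp_all add: frac_closure_def)

text \<open>Equations are carried over coefficientwise. Injectivity allows the way back, as it
  preserves degrees and reflects roots.\<close>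

lemma (in inj_comm_ring_hom) integral_wrt_image_iff:
  "integral_wrt (hom ` I) (hom x) \<longleftrightarrow> integral_wrt I x"
proof
  interpret p: map_poly_inj_comm_ring_hom hom ..
  {
    assume "integral_wrt I x"
    then obtain p where p: "Polynomial.lead_coeff p = 1"
      "\<And>i. i < Polynomial.degree p \<Longrightarrow> Polynomial.coeff p i \<in> I" "poly p x = 0"
      unfolding integral_wrt_def by blast
    then show "integral_wrt (hom ` I) (hom x)"
      unfolding integral_wrt_def by (intro exI[of _ "map_poly hom p"]) auto
  next
    assume "integral_wrt (hom ` I) (hom x)"
    then obtain p where p: "Polynomial.lead_coeff p = 1"
      "\<And>i. i < Polynomial.degree p \<Longrightarrow> Polynomial.coeff p i \<in> hom ` I" "poly p (hom x) = 0"
      unfolding integral_wrt_def by blast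
    \<comment> \<open>The leading coefficient \<open>1\<close> and the zeros above it also have
      preimages, though these may lie outside \<open>I\<close>.\<close>
    have "\<exists>a. hom a = Polynomial.coeff p i \<and> (i < Polynomial.degree p \<longrightarrow> a \<in> I)" for i
    proof (cases i "Polynomial.degree p" rule: linorder_cases)
      case less
      then show ?thesis using p(2) by (metis imageE)
    next
      case equal
      then show ?thesis using p(1) by (intro exI[of _ 1]) auto
    next
      case greater
      then show ?thesis by (intro exI[of _ 0]) (simp add: coeff_eq_0)
    qed
    then obtain c where c: "\<And>i. hom (c i) = Polynomial.coeff p i" "\<And>i. i < Polynomial.degree p \<Longrightarrow> c i \<in> I"
      by metis
    define q where "q = map_poly (inv_into UNIV hom) p"
    have coeff_q: "Polynomial.coeff q i = c i" for i
      unfolding q_def using inj_f by (simp add: coeff_map_poly c(1)[symmetric] flip: hom_zero)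
    have pq: "p = map_poly hom q"
      by (intro poly_eqI) (simp add: coeff_q c)
    show "integral_wrt I x"
      unfolding integral_wrt_def using p c(2) unfolding pq
      by (intro exI[of _ q]) (auto simp: coeff_q)
  }
qed

lemma ideal_ext_image:
  assumes "w \<in> ideal_ext S I"
  shows "frac_closure w \<in> ideal_ext (frac_closure ` S) (frac_closure ` I)"
  using assms by induction (auto simp: frac_closure.hom_add frac_closure.hom_mult intro: ideal_ext.intros)

section \<open>Correspondence between \<open>ring_ideal\<close> and the structures
  \<open>ring_on R\<close>\<close>

lemma (in ring_ideal) cring_ring_on: "cring (ring_on R)"
proof -
  have "\<exists>y\<in>R. y + x = 0" if "x \<in> R" for x
    using that ring_minus by (intro bexI[of _ "- x"]) auto
  then show ?thesis
    by unfold_locales (auto simp: algebra_simps Units_def ring_add ring_mult ring_one ring_zero)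
qed

lemma (in ring_ideal) a_inv_ring_on: "x \<in> R \<Longrightarrow> \<ominus>\<^bsub>ring_on R\<^esub> x = - x"
proof -
  interpret cring "ring_on R"
    by (rule cring_ring_on)
  show "x \<in> R \<Longrightarrow> \<ominus>\<^bsub>ring_on R\<^esub> x = - x"
    by (intro minus_equality) (auto simp: ring_minus)
qed

lemma subring_of_type_imp_ring_ideal:
  assumes "subring_of_type R"
  shows "ring_ideal R R"
proof -
  \<comment> \<open>This instance evaluates the additive inverse of \<open>ring_on UNIV\<close>,
    which occurs in the subring axioms.\<close>
  interpret U: ring_ideal UNIV "UNIV :: 'a set"
    by unfold_locales auto
  from subringE[OF assms] show ?thesis
    by unfold_locales (simp_all add: U.a_inv_ring_on)
qed

lemma (in ring_ideal) ideal_ring_on: "ideal I (ring_on R)"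
proof -
  interpret U: cring "ring_on R"
    by (rule cring_ring_on)
  have "subgroup I (add_monoid (ring_on R))"
  proof (rule U.add.subgroupI)
    fix x assume "x \<in> I"
    then show "\<ominus>\<^bsub>ring_on R\<^esub> x \<in> I"
      by (simp add: a_inv_ring_on ideal_minus ideal_in_ring)
  qed (use ideal_subset ideal_zero ideal_add in auto)
  then show ?thesis
    by (rule idealI[OF U.ring_axioms]) (auto simp: ideal_mult ideal_mult_right)
qed

lemma (in ring_ideal) ring_ideal_if_ideal:
  assumes "ideal J (ring_on R)"
  shows "ring_ideal R J"
proof -
  interpret ideal J "ring_on R" by fact
  show ?thesis
    using a_subset additive_subgroup.zero_closed[OF is_additive_subgroup]
      additive_subgroup.a_closed[OF is_additive_subgroup] I_l_closed
    by unfold_locales (auto intro: ring_one ring_minus ring_add ring_mult)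
qed

lemma (in ring_ideal) genideal_ring_on:
  assumes "J \<subseteq> R"
  shows "genideal (ring_on R) J = ideal_ext R J"
proof
  interpret U: cring "ring_on R"
    by (rule cring_ring_on)
  interpret E: ring_ideal R "ideal_ext R J"
    using assms by (rule ring_ideal_ext)
  have "J \<subseteq> ideal_ext R J"
    using ideal_ext_base[of _ J 1 R] ring_one by auto
  then show "genideal (ring_on R) J \<subseteq> ideal_ext R J"
    by (intro U.genideal_minimal E.ideal_ring_on)
  interpret G: ring_ideal R "genideal (ring_on R) J"
    using assms by (intro ring_ideal_if_ideal U.genideal_ideal) simp
  have J: "J \<subseteq> genideal (ring_on R) J"
    using assms U.genideal_self by simp
  have "w \<in> genideal (ring_on R) J" if "w \<in> ideal_ext R J" for w
    using that
    by induction (use J in \<open>auto intro: G.ideal_zero G.ideal_add G.ideal_mult_right\<close>)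
  then show "ideal_ext R J \<subseteq> genideal (ring_on R) J"
    by blast
qed

text \<open>Being a submonoid depends on the surrounding ring only through inclusion, so a monoid of
  \<open>R\<close> generates nothing new in \<open>S\<close>.\<close>

lemma monoid_gen_submonoid:
  assumes "submonoid U (ring_on R)" "R \<subseteq> S"
  shows "monoid_gen S U = U"
proof -
  interpret submonoid U "ring_on R" by fact
  have "submonoid U (ring_on S)"
    using subset assms(2) m_closed one_closed by unfold_locales auto
  then show ?thesis
    unfolding monoid_gen_def by blast
qed

lemma (in inj_comm_ring_hom) ring_ideal_image:
  assumes "ring_ideal R I"
  shows "ring_ideal (hom ` R) (hom ` I)"
proof -
  interpret ring_ideal R I by fact
  show ?thesis
  proof
    show "1 \<in> hom ` R" "0 \<in> hom ` I" "hom ` I \<subseteq> hom ` R"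
      using imageI[OF ring_one, of hom] imageI[OF ideal_zero, of hom] ideal_subset by auto
  qed (auto simp flip: hom_add hom_mult hom_uminus
      intro!: imageI intro: ring_minus ring_add ring_mult ideal_add ideal_mult)
qed

section \<open>Peeling off the members of the chain over \<open>R\<close>\<close>

context
  fixes R S :: "'a::idom set"
  assumes R: "ring_ideal R R" and S: "ring_ideal S S" and RS: "R \<subseteq> S"
    and int: "\<forall>x\<in>S. integral_over R x" and closed: "integrally_closed R"
begin

interpretation R: ring_ideal R R by (rule R)
interpretation S: ring_ideal S S by (rule S)

text \<open>Factoring the embedding through the fraction field, \<open>to_ac\<close> reflects
  integrality back to the level at which \<open>integrally_closed\<close> is stated.\<close>

lemma integrally_closed_frac_closure:
  assumes "a \<in> frac_closure ` R" "b \<in> frac_closure ` R" "b \<noteq> 0"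
    and "integral_wrt (frac_closure ` R) (a / b)"
  shows "a / b \<in> frac_closure ` R"
proof -
  have image: "frac_closure ` A = to_ac ` to_fract ` A" for A :: "'a set"
    by (auto simp: frac_closure_def)
  obtain c d where cd: "a = frac_closure c" "c \<in> R" "b = frac_closure d" "d \<in> R"
    using assms by blast
  have ab: "a / b = to_ac (Fraction_Field.Fract c d)"
    unfolding cd frac_closure_def by (simp add: Fract_conv_to_fract)
  interpret f: inj_comm_ring_hom "to_fract :: 'a \<Rightarrow> 'a fract"
    by unfold_locales simp_all
  interpret f: ring_ideal "to_fract ` R" "to_fract ` R"
    using R by (rule f.ring_ideal_image)
  have "d \<noteq> 0"
    using assms(3) cd by auto
  then have "Fraction_Field.Fract c d \<in> fractions_of R"
    unfolding fractions_of_def using cd by blast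
  moreover have "integral_over (to_fract ` R) (Fraction_Field.Fract c d)"
    using assms(4) unfolding ab image to_ac.integral_wrt_image_iff f.integral_wrt_iff .
  ultimately have "Fraction_Field.Fract c d \<in> to_fract ` R"
    using closed unfolding integrally_closed_def by blast
  then show ?thesis
    unfolding ab image by blast
qed

text \<open>Conjugacy supplies the radical and cancellation hypotheses of
  \<open>integral_wrt_cancel\<close>. The resulting equation of \<open>z\<close> over
  \<open>I\<close> places a power of \<open>z\<close> in \<open>I S\<close>.\<close>

lemma power_in_ideal_ext_cancel:
  assumes I: "ring_ideal R I" and U: "submonoid U (ring_on R)" "Defs.conjugate R I U"
    and u: "u \<in> U" and z: "z \<in> S" and uz: "u * z \<in> ideal_ext S I"
  shows "\<exists>n. z ^ n \<in> ideal_ext S I"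
proof -
  interpret I: ring_ideal R I by fact
  interpret U: submonoid U "ring_on R" by fact
  have cancel: "a \<in> I" if "a \<in> R" "s \<in> U" "s * a \<in> I" for a s
    using U(2) that unfolding Defs.conjugate_def by blast
  have uR: "u \<in> R"
    using U.subset u by auto
  show ?thesis
  proof (cases "u = 0")
    case True
    \<comment> \<open>If \<open>0 \<in> U\<close>, cancelling it from \<open>0 * 1 \<in> I\<close>
      makes \<open>I\<close> the whole ring.\<close>
    then have "1 \<in> I"
      using cancel[of 1 u] u I.ring_one I.ideal_zero by simp
    then have "z ^ 1 \<in> ideal_ext S I"
      using ideal_ext_base[of 1 I z S] z by simp
    then show ?thesis ..
  next
    case False
    have "integral_wrt (frac_closure ` I) (frac_closure z)"
    proof (rule integral_wrt_cancel)
      show RI: "ring_ideal (frac_closure ` R) (frac_closure ` I)"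
        using I by (rule frac_closure.ring_ideal_image)
      show "a / b \<in> frac_closure ` R" if "a \<in> frac_closure ` R" "b \<in> frac_closure ` R" "b \<noteq> 0"
        "integral_wrt (frac_closure ` R) (a / b)" for a b
        using that by (rule integrally_closed_frac_closure)
      \<comment> \<open>Conjugacy speaks of positive exponents; for exponent \<open>0\<close> the
        assumption is \<open>1 \<in> I\<close>.\<close>
      have "a \<in> I" if "a \<in> R" "a ^ n \<in> I" for a n
      proof (cases n)
        case 0
        then show ?thesis
          using that I.ideal_mult[of a 1] by simp
      next
        case (Suc k)
        then show ?thesis
          using U(2) that unfolding Defs.conjugate_def by blast
      qed
      then show "a \<in> frac_closure ` I" if "a \<in> frac_closure ` R" "a ^ n \<in> frac_closure ` I" for a n
        using that by (auto simp flip: frac_closure.hom_power)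
      show "frac_closure u \<in> frac_closure ` R" "frac_closure u \<noteq> 0"
        using uR False by auto
      show "a \<in> frac_closure ` I" if "a \<in> frac_closure ` R" "frac_closure u * a \<in> frac_closure ` I" for a
        using that cancel u by (auto simp flip: frac_closure.hom_mult)
      have int_S: "integral_wrt (frac_closure ` R) (frac_closure s)" if "s \<in> S" for s
        using int that by (simp add: frac_closure.integral_wrt_image_iff R.integral_wrt_iff)
      then show "integral_wrt (frac_closure ` R) (frac_closure z)"
        using z by blast
      interpret F: ring_ideal_in_field "frac_closure ` R" "frac_closure ` I"
        using RI by (simp add: ring_ideal_in_field_def)
      have "frac_closure (u * z) \<in> ideal_ext {x. integral_wrt (frac_closure ` R) x} (frac_closure ` I)"
        using int_S by (intro ideal_ext_mono[OF ideal_ext_image[OF uz]]) auto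
      then show "integral_wrt (frac_closure ` I) (frac_closure u * frac_closure z)"
        using F.integral_wrt_if_ideal_ext by (simp add: frac_closure.hom_mult)
    qed
    then have "integral_wrt I z"
      by (simp only: frac_closure.integral_wrt_image_iff)
    then obtain n c where c: "\<And>i. i < n \<Longrightarrow> c i \<in> I" and n: "z ^ n = - (\<Sum>i<n. c i * z ^ i)"
      by (rule integral_wrtE) blast
    interpret E: ring_ideal S "ideal_ext S I"
      using I.ideal_subset RS by (intro S.ring_ideal_ext) auto
    have "z ^ n \<in> ideal_ext S I"
      unfolding n using c z by (intro E.ideal_minus E.ideal_sum ideal_ext_base S.ring_power) auto
    then show ?thesis ..
  qed
qed

text \<open>Induction from the outermost member inwards. \<open>I\<close> is the ideal of the member
  peeled off last, and \<open>qs\<close> is the untouched inner part of the expression. Modulo the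
  radical of \<open>J S\<close> the summand \<open>j\<close> disappears and the factor
  \<open>u\<close> is cancelled.\<close>

lemma collapse_expr_power_in_ideal_ext:
  assumes "list_all2 (\<lambda>(j, u) (J, U). j \<in> ideal_ext S J \<and> u \<in> U) ps C"
    and "\<forall>(J, U) \<in> set C. ring_ideal R J \<and> submonoid U (ring_on R) \<and> Defs.conjugate R J U"
    and "successively (\<subseteq>) (I # map fst C)"
    and "collapse_expr qs \<in> S" and "collapse_expr (ps @ qs) ^ n \<in> ideal_ext S I"
  shows "\<exists>m. collapse_expr qs ^ m \<in> ideal_ext S (last (I # map fst C))"
  using assms
proof (induction ps C arbitrary: I n rule: list_all2_induct)
  case Nil
  then show ?case by auto
next
  case (Cons p ps c C)
  obtain j u J U where p: "p = (j, u)" and c: "c = (J, U)"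
    by fastforce
  have ju: "j \<in> ideal_ext S J" "u \<in> U" and J: "ring_ideal R J"
    and U: "submonoid U (ring_on R)" "Defs.conjugate R J U" and IJ: "I \<subseteq> J"
    using Cons by (auto simp: p c)
  interpret J: ring_ideal R J by (rule J)
  interpret U: submonoid U "ring_on R" by (rule U)
  interpret E: ring_ideal S "ideal_ext S J"
    using J.ideal_subset RS by (intro S.ring_ideal_ext) auto
  interpret rad: ring_ideal S "{x \<in> S. \<exists>n. x ^ n \<in> ideal_ext S J}"
    by (rule E.ring_ideal_radical)
  have US: "U \<subseteq> S"
    using U.subset RS by auto
  have "collapse_expr (ps @ qs) \<in> S"
    using Cons.hyps(2) Cons.prems(1,3)
  proof (induction ps C rule: list_all2_induct)
    case (Cons p ps c C)
    obtain j u J U where p: "p = (j, u)" and c: "c = (J, U)"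
      by fastforce
    have J: "ring_ideal R J" "submonoid U (ring_on R)" "j \<in> ideal_ext S J" "u \<in> U"
      using Cons by (auto simp: p c)
    interpret E: ring_ideal S "ideal_ext S J"
      using ring_ideal.ideal_subset[OF J(1)] RS by (intro S.ring_ideal_ext) auto
    have "u \<in> S" "j \<in> S"
      using submonoid.subset[OF J(2)] J(3,4) RS E.ideal_in_ring by auto
    then show ?case
      using Cons by (auto simp: p intro!: S.ring_add S.ring_mult)
  qed simp
  let ?e = "collapse_expr (ps @ qs)"
  have uS: "u \<in> S"
    using ju US by blast
  have "u * ?e + j \<in> {x \<in> S. \<exists>n. x ^ n \<in> ideal_ext S J}"
    using Cons.prems(4) ideal_ext_mono[OF _ order.refl IJ] uS \<open>?e \<in> S\<close> E.ideal_in_ring[OF ju(1)]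
    by (auto simp: p intro!: S.ring_add S.ring_mult)
  moreover have "j \<in> {x \<in> S. \<exists>n. x ^ n \<in> ideal_ext S J}"
    using ju(1) E.ideal_in_ring by (auto intro!: exI[of _ 1])
  ultimately have "u * ?e \<in> {x \<in> S. \<exists>n. x ^ n \<in> ideal_ext S J}"
    using rad.ideal_diff by fastforce
  then obtain k where "u ^ k * ?e ^ k \<in> ideal_ext S J"
    by (auto simp: power_mult_distrib)
  \<comment> \<open>Since \<open>U\<close> is a monoid, the whole factor \<open>u ^ k\<close> is
    cancelled at once.\<close>
  moreover have "u ^ k \<in> U"
    using ju(2) U.m_closed U.one_closed by (induction k) auto
  ultimately obtain l where "(?e ^ k) ^ l \<in> ideal_ext S J"
    using power_in_ideal_ext_cancel[OF J U] S.ring_power[OF \<open>?e \<in> S\<close>] by blast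
  then have "?e ^ (k * l) \<in> ideal_ext S J"
    by (simp add: power_mult)
  with Cons show ?case
    by (auto simp: c)
qed

end

section \<open>Collapse of complete chains\<close>

text \<open>From the inside outwards: the value of the tail lies in the next monoid, hence in the
  larger \<open>U\<close>, which is closed under products and under translation by
  \<open>J\<close>.\<close>

lemma collapse_expr_in_first_monoid:
  assumes "list_all2 (\<lambda>(j, u) (J, U). j \<in> J \<and> u \<in> U) ps C" and "C \<noteq> []"
    and "\<forall>(J, U) \<in> set C. submonoid U (ring_on S) \<and> (\<forall>j\<in>J. \<forall>u\<in>U. j + u \<in> U)"
    and "successively (\<supseteq>) (map snd C)"
  shows "collapse_expr ps \<in> snd (hd C)"
  using assms
proof (induction ps C rule: list_all2_induct)
  case (Cons p ps c C)
  obtain j u J U where p: "p = (j, u)" and c: "c = (J, U)"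
    by fastforce
  have ju: "j \<in> J" "u \<in> U" and "submonoid U (ring_on S)"
    and JU: "\<forall>j\<in>J. \<forall>u\<in>U. j + u \<in> U"
    using Cons by (auto simp: p c)
  then interpret submonoid U "ring_on S" by simp
  have "collapse_expr ps \<in> U"
  proof (cases "C = []")
    \<comment> \<open>The empty tail has the value \<open>1\<close>, which lies in every
      monoid.\<close>
    case True
    then show ?thesis
      using Cons.hyps(2) one_closed by simp
  next
    case False
    then have "snd (hd C) \<subseteq> U"
      using Cons.prems(3) by (cases C) (auto simp: c)
    then show ?thesis
      using Cons False by (cases C) (auto simp: c)
  qed
  then have "u * collapse_expr ps \<in> U"
    using ju(2) m_closed by simp
  then have "j + u * collapse_expr ps \<in> U"
    using ju(1) JU by blast
  then show ?case
    by (simp add: p c add.commute)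
qed simp

text \<open>The first member contributes the factor \<open>0\<close>; the pair \<open>(0, 1)\<close>
  is available for all the others.\<close>

lemma collapses_if_zero_in:
  assumes "ring_ideal S S" "0 \<in> snd (hd C)" "C \<noteq> []" "\<forall>(J, U) \<in> set C. J \<subseteq> S"
  shows "collapses S C"
proof -
  interpret ring_ideal S S by fact
  have zero: "0 \<in> genideal (ring_on S) J" if "J \<subseteq> S" for J
    using that by (simp add: genideal_ring_on ideal_ext.zero)
  have one: "1 \<in> monoid_gen S U" for U
    unfolding monoid_gen_def using submonoid.one_closed by fastforce
  obtain J U C' where C: "C = (J, U) # C'"
    using assms(3) by (cases C) auto
  have "0 \<in> monoid_gen S U"
    using assms(2) unfolding monoid_gen_def C by auto
  then have "list_all2 (\<lambda>(j, u) (J, U). j \<in> genideal (ring_on S) J \<and> u \<in> monoid_gen S U)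
      ((0, 0) # map (\<lambda>_. (0, 1)) C') C"
    using assms(4) zero one by (auto simp: C list.rel_map intro!: list.rel_refl_strong)
  then show ?thesis
    unfolding collapses_def by (intro exI[of _ "(0, 0) # map (\<lambda>_. (0, 1)) C'"]) auto
qed

text \<open>\<open>R\<close> is the ring that contains the monoids, so the lemma covers
  \<open>C1\<close>, and with \<open>R = S\<close> also \<open>C2\<close>.\<close>

lemma list_all2_ideal_ext_if_collapse:
  assumes "ring_ideal S S" "R \<subseteq> S" "\<forall>(J, U) \<in> set C. J \<subseteq> S \<and> submonoid U (ring_on R)"
    and "list_all2 (\<lambda>(j, u) (J, U). j \<in> genideal (ring_on S) J \<and> u \<in> monoid_gen S U) ps C"
  shows "list_all2 (\<lambda>(j, u) (J, U). j \<in> ideal_ext S J \<and> u \<in> U) ps C"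
  using assms(4)
proof (rule list.rel_mono_strong)
  interpret ring_ideal S S by fact
  fix p c
  assume "c \<in> set C"
    and "(case p of (j, u) \<Rightarrow> \<lambda>(J, U). j \<in> genideal (ring_on S) J \<and> u \<in> monoid_gen S U) c"
  then show "(case p of (j, u) \<Rightarrow> \<lambda>(J, U). j \<in> ideal_ext S J \<and> u \<in> U) c"
    using assms(2,3) by (cases p, cases c) (auto simp: genideal_ring_on monoid_gen_submonoid)
qed

lemma (in ring_ideal) ideal_ext_subset: "w \<in> ideal_ext R I \<Longrightarrow> w \<in> I"
  by (induction rule: ideal_ext.induct) (auto intro: ideal_zero ideal_add ideal_mult_right)

theorem theorem4p17:
  fixes R S :: "'a::idom set" and C1 C2 :: "'a idealistic_chain"
  assumes "subring_of_type R" and "subring_of_type S" and "R \<subseteq> S"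
    and "\<forall>x \<in> S. integral_over R x"
    and "integrally_closed R"
    and "saturated_chain R C1" and "C1 \<noteq> []"
    and "saturated_chain S C2" and "C2 \<noteq> []"
    and "last (chain_ideals C1) \<subseteq> hd (chain_ideals (chain_trace R C2))"
    and "collapses S (C1 @ C2)"
  shows "collapses S C2"
proof -
  have RS: "ring_ideal R R" "ring_ideal S S"
    using assms(1,2) subring_of_type_imp_ring_ideal by blast+
  interpret R: ring_ideal R R by (rule RS)
  interpret S: ring_ideal S S by (rule RS)
  have C1: "ring_ideal R J" "submonoid U (ring_on R)" "Defs.conjugate R J U" if "(J, U) \<in> set C1" for J U
    using assms(6) that R.ring_ideal_if_ideal
    unfolding saturated_chain_def complete_chain_def by auto
  have C2: "ring_ideal S J" "submonoid U (ring_on S)" "{j + u | j u. j \<in> J \<and> u \<in> U} = U"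
    if "(J, U) \<in> set C2" for J U
  proof -
    have "\<forall>(J, U) \<in> set C2. ideal J (ring_on S) \<and> submonoid U (ring_on S)
        \<and> {j + u | j u. j \<in> J \<and> u \<in> U} = U"
      using assms(8) unfolding saturated_chain_def complete_chain_def by (elim conjE)
    from bspec[OF this that] show "ring_ideal S J" "submonoid U (ring_on S)"
      "{j + u | j u. j \<in> J \<and> u \<in> U} = U"
      unfolding prod.case using S.ring_ideal_if_ideal by (elim conjE; assumption | simp)+
  qed
  have mono1: "successively (\<subseteq>) (map fst C1)" and mono2: "successively (\<supseteq>) (map snd C2)"
    using assms(6,8) unfolding saturated_chain_def complete_chain_def
    by (simp_all add: successively_conv_nth)
  obtain ps where ps: "list_all2 (\<lambda>(j, u) (J, U). j \<in> genideal (ring_on S) J \<and> u \<in> monoid_gen S U) ps (C1 @ C2)"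
    and zero: "collapse_expr ps = 0"
    using assms(11) unfolding collapses_def by blast
  obtain ps1 ps2 where split: "ps = ps1 @ ps2"
    and ps1: "list_all2 (\<lambda>(j, u) (J, U). j \<in> genideal (ring_on S) J \<and> u \<in> monoid_gen S U) ps1 C1"
    and ps2: "list_all2 (\<lambda>(j, u) (J, U). j \<in> genideal (ring_on S) J \<and> u \<in> monoid_gen S U) ps2 C2"
    using ps unfolding list_all2_append2 by blast
  have ext1: "list_all2 (\<lambda>(j, u) (J, U). j \<in> ideal_ext S J \<and> u \<in> U) ps1 C1"
  proof (rule list_all2_ideal_ext_if_collapse[OF RS(2) assms(3) _ ps1])
    show "\<forall>(J, U) \<in> set C1. J \<subseteq> S \<and> submonoid U (ring_on R)"
      using C1 ring_ideal.ideal_subset assms(3) by fastforce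
  qed
  have "list_all2 (\<lambda>(j, u) (J, U). j \<in> ideal_ext S J \<and> u \<in> U) ps2 C2"
  proof (rule list_all2_ideal_ext_if_collapse[OF RS(2) order.refl _ ps2])
    show "\<forall>(J, U) \<in> set C2. J \<subseteq> S \<and> submonoid U (ring_on S)"
      using C2 ring_ideal.ideal_subset by fastforce
  qed
  then have ps2_in: "list_all2 (\<lambda>(j, u) (J, U). j \<in> J \<and> u \<in> U) ps2 C2"
    by (rule list.rel_mono_strong) (use C2 ring_ideal.ideal_ext_subset in fastforce)
  have x: "collapse_expr ps2 \<in> snd (hd C2)"
  proof (rule collapse_expr_in_first_monoid[OF ps2_in assms(9) _ mono2])
    show "\<forall>(J, U) \<in> set C2. submonoid U (ring_on S) \<and> (\<forall>j\<in>J. \<forall>u\<in>U. j + u \<in> U)"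
      using C2(2,3) by blast
  qed
  obtain J V where hd: "hd C2 = (J, V)" "(J, V) \<in> set C2"
    using assms(9) by (metis hd_in_set surj_pair)
  interpret J: ring_ideal S J
    using C2 hd by blast
  interpret V: submonoid V "ring_on S"
    using C2 hd by blast
  \<comment> \<open>The peeling may start at the first ideal of \<open>C1\<close> itself, because
    the full expression is \<open>0\<close> and lies in every extended ideal.\<close>
  have "\<exists>m. collapse_expr ps2 ^ m \<in> ideal_ext S (last (fst (hd C1) # map fst C1))"
  proof (rule collapse_expr_power_in_ideal_ext[OF RS assms(3,4,5) ext1])
    show "\<forall>(J, U) \<in> set C1. ring_ideal R J \<and> submonoid U (ring_on R) \<and> Defs.conjugate R J U"
      using C1 by blast
    show "successively (\<subseteq>) (fst (hd C1) # map fst C1)"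
      using mono1 assms(7) by (cases C1) auto
    show "collapse_expr ps2 \<in> S"
      using x V.subset by (auto simp: hd)
    show "collapse_expr (ps1 @ ps2) ^ 1 \<in> ideal_ext S (fst (hd C1))"
      using zero by (simp add: split ideal_ext.zero)
  qed
  \<comment> \<open>The last ideal of \<open>C1\<close> lies in the trace of \<open>J\<close>, hence
    in \<open>J\<close>, and its extension to \<open>S\<close> stays inside
    \<open>J\<close>.\<close>
  moreover have "last (fst (hd C1) # map fst C1) \<subseteq> J"
    using assms(7,9,10) hd(1) by (cases C2) (auto simp: chain_ideals_def chain_trace_def)
  ultimately obtain m where "collapse_expr ps2 ^ m \<in> J"
    using ideal_ext_mono[OF _ order.refl] J.ideal_ext_subset by blast
  then have "- (collapse_expr ps2 ^ m) \<in> J"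
    by (rule J.ideal_minus)
  \<comment> \<open>The power lies in both \<open>J\<close> and \<open>V\<close>, so
    \<open>J + V = V\<close> yields \<open>0 \<in> V\<close>.\<close>
  moreover have "collapse_expr ps2 ^ m \<in> V"
    using x V.m_closed V.one_closed by (induction m) (auto simp: hd)
  ultimately have "- (collapse_expr ps2 ^ m) + collapse_expr ps2 ^ m \<in> V"
    using C2(3)[OF hd(2)] by blast
  then have "0 \<in> snd (hd C2)"
    by (simp add: hd)
  then show ?thesis
  proof (rule collapses_if_zero_in[OF RS(2) _ assms(9)])
    show "\<forall>(J, U) \<in> set C2. J \<subseteq> S"
      using C2(1) ring_ideal.ideal_subset by blast
  qed
qed

end
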